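(* Let $\mathcal X,\mathcal Y$ be finite-dimensional Euclidean spaces, $A:\mathcal X\to\mathcal Y$ a linear map with adjoint $A^*$, $b\in\mathcal Y$, and $\rho:\mathcal Y\to\mathbb R\cup\{+\infty\}$ a closed gauge. Let $0<\sigma<\rho(b)$, and let $$\mathcal C=\{x\in\mathcal X\mid\rho(b-Ax)\le\sigma\},\qquad\mathcal C_0=\{u\in\mathcal Y\mid\rho(b-u)\le\sigma\},$$ where $\mathcal C$ is nonempty. If $\mathcal C_0$ is polyhedral, or $\operatorname{ri}\mathcal C_0\cap\operatorname{range}A\neq\emptyset$, then $$\mathcal C'=\{A^*y\mid\langle b,y\rangle-\sigma\rho^\circ(y)\ge1\}.$$
   Context: A gauge is a nonnegative, positively homogeneous convex function $\rho$ with values in $\mathbb R\cup\{+\infty\}$ and $\rho(0)=0$; it is closed if its epigraph is closed. Its polar is the gauge $\rho^\circ(y)=\inf\{\mu>0\mid\langle x,y\rangle\le\mu\rho(x)\ \forall x\}$ (with $\inf\emptyset=+\infty$). The antipolar of a set $\mathcal D$ is $\mathcal D'=\{y\mid\langle y,x\rangle\ge1\ \forall x\in\mathcal D\}$. $\operatorname{ri}$ denotes relative interior. *)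

theory Defs
  imports "HOL-Analysis.Analysis"
begin

text \<open>
  Functions with values in the reals extended by plus infinity are of type
  \<^typ>\<open>'a \<Rightarrow> ereal\<close>; nonnegativity rules out minus infinity. The name
  \<open>gauge\<close> is used in the library for Henstock-Kurzweil integration, hence
  \<open>gauge_function\<close> below.
\<close>

definition gauge_function :: "('a::real_vector \<Rightarrow> ereal) \<Rightarrow> bool" where
  "gauge_function \<rho> \<longleftrightarrow>
     (\<forall>x. 0 \<le> \<rho> x) \<and>
     \<rho> 0 = 0 \<and>
     (\<forall>t>0. \<forall>x. \<rho> (t *\<^sub>R x) = ereal t * \<rho> x) \<and>
     (\<forall>x y. \<forall>t. 0 < t \<and> t < 1 \<longrightarrow>
        \<rho> ((1 - t) *\<^sub>R x + t *\<^sub>R y) \<le> ereal (1 - t) * \<rho> x + ereal t * \<rho> y)"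

text \<open>The library's \<^const>\<open>epigraph\<close> is for real-valued functions only.\<close>

definition ereal_epigraph :: "('a \<Rightarrow> ereal) \<Rightarrow> ('a \<times> real) set" where
  "ereal_epigraph f = {(x, r). f x \<le> ereal r}"

definition closed_gauge :: "('a::real_normed_vector \<Rightarrow> ereal) \<Rightarrow> bool" where
  "closed_gauge \<rho> \<longleftrightarrow> gauge_function \<rho> \<and> closed (ereal_epigraph \<rho>)"

text \<open>The infimum of the empty set in \<^typ>\<open>ereal\<close> is \<open>\<infinity>\<close>, and
  \<open>ereal \<mu> * \<infinity> = \<infinity>\<close> for \<open>\<mu> > 0\<close>, so points outside
  the domain of \<open>\<rho>\<close> impose no constraint on \<open>\<mu>\<close>.\<close>

definition polar_gauge :: "('a::real_inner \<Rightarrow> ereal) \<Rightarrow> 'a \<Rightarrow> ereal" where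
  "polar_gauge \<rho> y =
     Inf {ereal \<mu> | \<mu>. \<mu> > 0 \<and> (\<forall>x. ereal (inner x y) \<le> ereal \<mu> * \<rho> x)}"

definition antipolar :: "'a::real_inner set \<Rightarrow> 'a set" where
  "antipolar D = {y. \<forall>x\<in>D. inner y x \<ge> 1}"

end

theory Submission
  imports Defs
begin

text \<open>
  The scaled polar \<open>\<sigma> \<rho>\<degree>\<close> is the support function of the sublevel set
  \<open>{v. \<rho> v \<le> \<sigma>}\<close>, so the constraint on \<open>y\<close> says exactly that
  \<open>y\<close> lies in the antipolar of \<open>C0\<close>. Since \<open>C\<close> is the preimage of
  \<open>C0\<close> under \<open>A\<close>, what remains is that every \<open>z\<close> in the antipolar of
  the preimage is \<open>adjoint A y\<close> for some \<open>y\<close> in the antipolar of \<open>C0\<close>.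
  In the polyhedral case this is Farkas' lemma; in the other case it is proper separation of the
  origin from \<open>{(u - A x, inner z x - t) | u \<in> C0, t < 1}\<close>, where the relative interior point
  excludes a vertical hyperplane.
\<close>

section \<open>Convex sets whose relative interior meets the range\<close>

lemma antipolar_vimage_rel_interior:
  fixes A :: "'a::euclidean_space \<Rightarrow> 'b::euclidean_space"
  assumes A: "linear A" and "convex K"
    and ri: "rel_interior K \<inter> range A \<noteq> {}"
    and z: "z \<in> antipolar (A -` K)"
  obtains y where "y \<in> antipolar K" "z = adjoint A y"
proof -
  interpret A: linear A by fact
  obtain x0 where x0: "A x0 \<in> rel_interior K" using ri by blast
  then have K0: "A x0 \<in> K" using rel_interior_subset by blast
  \<comment> \<open>Being a Minkowski difference of a convex set and a linear image of one,
    \<open>S\<close> is convex by closure rules alone.\<close>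
  define S where "S = (\<Union>k \<in> K \<times> {0::real}. \<Union>r \<in> (\<lambda>(x, t). (A x, t - inner z x)) ` (UNIV \<times> {..<1}). {k - r})"
  have S: "(u - A x, inner z x - t) \<in> S" if "u \<in> K" "t < 1" for u x t
    using that by (force simp: S_def)
  have Sc: "\<exists>u x t. u \<in> K \<and> t < 1 \<and> p = (u - A x, inner z x - t)" if "p \<in> S" for p
    using that by (auto simp: S_def)
  have "linear (\<lambda>(x, t). (A x, t - inner z x))"
    by (rule linearI) (auto simp: A.add A.scale inner_add_right algebra_simps)
  then have "convex S"
    unfolding S_def using \<open>convex K\<close>
    by (intro convex_differences convex_linear_image convex_Times) auto
  moreover have "S \<noteq> {}" using S[OF K0, of 0] by auto
  moreover have "0 \<notin> S"
  proof
    assume "0 \<in> S"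
    from Sc[OF this] obtain x t where "A x \<in> K" "t < 1" "inner z x = t"
      by (auto simp: zero_prod_def)
    with z show False by (force simp: antipolar_def)
  qed
  \<comment> \<open>Membership in \<open>span S\<close> makes the separation proper: a nonzero
    \<open>a\<close> there cannot be orthogonal to all of \<open>S\<close>.\<close>
  ultimately obtain a where a: "a \<in> span S" "a \<noteq> 0" "\<And>p. p \<in> S \<Longrightarrow> 0 \<le> inner a p"
    using separating_hyperplane_set_0_inspan by metis
  obtain w s where ws: "a = (w, s)" by (cases a)
  have sep: "t * s + inner w (A x) \<le> inner w u + s * inner z x" if "u \<in> K" "t < 1" for u x t
    using a(3)[OF S[OF that]] by (simp add: ws inner_diff_right algebra_simps)
  have adj: "adjoint A w = s *\<^sub>R z"
  proof -
    \<comment> \<open>A linear functional bounded above on the whole space vanishes; the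
      \<open>c\<close> substituted next would push the left side past the bound.\<close>
    have "c * inner (adjoint A w - s *\<^sub>R z) x \<le> inner w (A x0)" for c x
      using sep[OF K0, of 0 "c *\<^sub>R x"]
      by (simp add: A.scale inner_diff_left adjoint_clauses[OF A] algebra_simps)
    note le = this[of "(\<bar>inner w (A x0)\<bar> + 1) / inner (adjoint A w - s *\<^sub>R z) x" x for x]
    have "inner (adjoint A w - s *\<^sub>R z) x = 0" for x
      using le[of x] by (cases "inner (adjoint A w - s *\<^sub>R z) x = 0") auto
    then have "adjoint A w - s *\<^sub>R z = 0" using inner_eq_zero_iff by blast
    then show ?thesis by simp
  qed
  have te: "t * s \<le> inner w u" if "t < 1" "u \<in> K" for t u
    using sep[OF that(2,1), of 0] by (simp add: A.zero)
  have le: "s \<le> inner w u" if "u \<in> K" for u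
    by (rule field_le_mult_one_interval) (use te that in auto)
  \<comment> \<open>If \<open>s = 0\<close>, then \<open>w\<close> vanishes on the range of
    \<open>A\<close> and is nonnegative on \<open>K\<close>. Prolonging the segment from
    \<open>u\<close> through the relative interior point \<open>A x0\<close> forces
    \<open>inner w u = 0\<close>, so \<open>a\<close> is orthogonal to \<open>S\<close>.\<close>
  have "s \<noteq> 0"
  proof
    assume s: "s = 0"
    then have wA: "inner w (A x) = 0" for x
      using adj adjoint_clauses(2)[OF A, of w x] by simp
    have wK: "inner w u = 0" if "u \<in> K" for u
    proof -
      obtain c where c: "c > 1" "(1 - c) *\<^sub>R u + c *\<^sub>R A x0 \<in> K"
        using convex_rel_interior_if2[OF \<open>convex K\<close> x0] hull_inc[OF \<open>u \<in> K\<close>] by metis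
      have "0 \<le> (1 - c) * inner w u"
        using le[OF c(2)] s wA by (simp add: inner_add_right)
      with le[OF that] s c(1) show ?thesis
        by (simp add: zero_le_mult_iff)
    qed
    have "S \<subseteq> {p. inner a p = 0}"
      using Sc wK wA s by (fastforce simp: ws inner_diff_right)
    then have "span S \<subseteq> {p. inner a p = 0}"
      by (intro span_minimal subspace_hyperplane)
    with a show False by auto
  qed
  moreover have "s \<ge> 0"
  proof (rule ccontr)
    assume s: "\<not> s \<ge> 0"
    \<comment> \<open>For this \<open>t\<close> the product \<open>t * s\<close> exceeds
      \<open>inner w (A x0)\<close>, against \<open>te\<close>.\<close>
    have "(\<bar>inner w (A x0)\<bar> + 1) / s < 1"
      using s by (intro less_trans[OF divide_pos_neg]) auto
    from te[OF this K0] s show False by simp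
  qed
  ultimately have s: "s > 0" by simp
  show ?thesis
  proof (rule that)
    show "(1 / s) *\<^sub>R w \<in> antipolar K" using s le by (simp add: antipolar_def)
    show "z = adjoint A ((1 / s) *\<^sub>R w)"
      using s adj by (simp add: linear_cmul[OF adjoint_linear[OF A]])
  qed
qed

section \<open>Polyhedra and Farkas' lemma\<close>

text \<open>As 0 lies in \<open>Q\<close>, the level \<open>b\<close> of a strictly separating
  hyperplane is negative. A point of \<open>Q\<close> with negative inner product could be scaled
  onto that hyperplane, contradicting strictness.\<close>

lemma closed_convex_cone_separation:
  fixes Q :: "'a::euclidean_space set"
  assumes "convex_cone Q" "closed Q" "p \<notin> Q"
  obtains a where "\<And>q. q \<in> Q \<Longrightarrow> 0 \<le> inner a q" "inner a p < 0"
proof -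
  obtain a b where a: "inner a p < b" "\<And>q. q \<in> Q \<Longrightarrow> b < inner a q"
    using separating_hyperplane_closed_point[of Q p] assms by (auto simp: convex_cone_def)
  have b: "b < 0" using a(2)[of 0] assms convex_cone_contains_0 by auto
  have "0 \<le> inner a q" if "q \<in> Q" for q
  proof (rule ccontr)
    assume neg: "\<not> ?thesis"
    have "(b / inner a q) *\<^sub>R q \<in> Q"
      using neg b assms that by (intro convex_cone_scaleR) (auto simp: divide_nonpos_neg)
    from a(2)[OF this] neg show False by simp
  qed
  then show ?thesis using that a b by force
qed

lemma antipolar_vimage_polyhedron:
  fixes A :: "'a::euclidean_space \<Rightarrow> 'b::euclidean_space"
  assumes A: "linear A" and "polyhedron K"
    and ne: "A -` K \<noteq> {}"
    and z: "z \<in> antipolar (A -` K)"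
  obtains y where "y \<in> antipolar K" "z = adjoint A y"
proof -
  interpret A: linear A by fact
  note adj = adjoint_linear[OF A]
  obtain x0 where x0: "A x0 \<in> K" using ne by blast
  obtain F where F: "finite F" "K = \<Inter>F"
    "\<forall>h\<in>F. \<exists>a \<beta>. a \<noteq> 0 \<and> h = {x. inner a x \<le> \<beta>}"
    using \<open>polyhedron K\<close> unfolding polyhedron_def by blast
  then obtain a \<beta> where h: "\<And>h. h \<in> F \<Longrightarrow> h = {x. inner (a h) x \<le> \<beta> h}" by metis
  have K: "u \<in> K \<longleftrightarrow> (\<forall>h\<in>F. inner (a h) u \<le> \<beta> h)" for u
    using h F(2) by blast
  \<comment> \<open>A pair encodes a linear inequality by normal and right-hand side.
    \<open>G\<close> holds the facets of \<open>K\<close> pulled back by \<open>A\<close> and the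
    trivial 0 \<le> 1, which later gives \<open>0 \<le> s\<close>; \<open>P\<close> holds all
    pulled-back inequalities valid on \<open>K\<close>.\<close>
  define G where "G = insert (0, 1) ((\<lambda>h. (adjoint A (a h), \<beta> h)) ` F)"
  define P where "P = {(adjoint A y, d) | y d. \<forall>u\<in>K. inner y u \<le> d}"
  have "convex_cone P"
    unfolding convex_cone_iff
  proof (intro conjI ballI allI impI)
    show "0 \<in> P"
      by (force simp: P_def zero_prod_def linear_0[OF adj] intro: exI[of _ 0])
  next
    fix p q assume "p \<in> P" "q \<in> P"
    then obtain y d y' d' where "p = (adjoint A y, d)" "q = (adjoint A y', d')"
      "\<forall>u\<in>K. inner y u \<le> d" "\<forall>u\<in>K. inner y' u \<le> d'" by (auto simp: P_def)
    then show "p + q \<in> P"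
      by (auto simp: P_def linear_add[OF adj] inner_add_left intro!: exI[of _ "y + y'"] add_mono)
  next
    fix p and c :: real assume "p \<in> P" "c \<ge> 0"
    then obtain y d where "p = (adjoint A y, d)" "\<forall>u\<in>K. inner y u \<le> d" by (auto simp: P_def)
    with \<open>c \<ge> 0\<close> show "c *\<^sub>R p \<in> P"
      by (auto simp: P_def linear_cmul[OF adj] intro!: exI[of _ "c *\<^sub>R y"] mult_left_mono)
  qed
  moreover have "G \<subseteq> P"
    unfolding G_def P_def using K by (force simp: linear_0[OF adj] intro: exI[of _ 0])
  ultimately have GP: "convex_cone hull G \<subseteq> P" by (simp add: hull_minimal)
  have "(- z, - 1) \<in> convex_cone hull G"
  proof (rule ccontr)
    assume "\<not> ?thesis"
    \<comment> \<open>Finiteness of the facet set enters here: a finitely generated cone is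
      closed.\<close>
    moreover have "closed (convex_cone hull G)"
      using F(1) by (intro closed_convex_cone_hull) (simp add: G_def)
    ultimately obtain q where q: "\<And>g. g \<in> convex_cone hull G \<Longrightarrow> 0 \<le> inner q g"
      "inner q (- z, - 1) < 0"
      using closed_convex_cone_separation[OF convex_cone_convex_cone_hull] by metis
    obtain x s where xs: "q = (x, s)" by (cases q)
    have G: "0 \<le> inner x v + s * d" if "(v, d) \<in> G" for v d
      using q(1)[OF hull_inc[OF that]] by (simp add: xs)
    have s: "0 \<le> s" using G[of 0 1] by (simp add: G_def)
    have facet: "0 \<le> inner (a h) (A x) + s * \<beta> h" if "h \<in> F" for h
      using G[of "adjoint A (a h)" "\<beta> h"] that
      by (simp add: G_def adjoint_works[OF A] inner_commute)
    have pos: "0 < inner z x + s" using q(2) by (simp add: xs inner_commute)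
    show False
    \<comment> \<open>If \<open>s = 0\<close>, then \<open>- x\<close> is a recession direction of
      the preimage along which \<open>inner z\<close> falls without bound; \<open>c\<close> is large
      enough to bring it down to at most 0. If \<open>s > 0\<close>, then \<open>- x / s\<close>
      lies in the preimage and has inner product below 1 with \<open>z\<close>.\<close>
    proof (cases "s = 0")
      case True
      then have zx: "inner z x > 0" using pos by simp
      define c where "c = \<bar>inner z x0\<bar> / inner z x"
      have c: "c \<ge> 0" "c * inner z x = \<bar>inner z x0\<bar>" using zx by (auto simp: c_def)
      have "inner (a h) (A (x0 - c *\<^sub>R x)) \<le> \<beta> h" if "h \<in> F" for h
      proof -
        have "0 \<le> c * inner (a h) (A x)" using facet[OF that] True c by simp
        moreover have "inner (a h) (A x0) \<le> \<beta> h" using x0 K that by blast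
        ultimately show ?thesis by (simp add: A.diff A.scale inner_diff_right)
      qed
      then have "A (x0 - c *\<^sub>R x) \<in> K" using K by blast
      then have "1 \<le> inner z (x0 - c *\<^sub>R x)" using z unfolding antipolar_def by blast
      with c show False by (simp add: inner_diff_right)
    next
      case False
      with s have s: "s > 0" by simp
      have "inner (a h) (A (- (1 / s) *\<^sub>R x)) \<le> \<beta> h" if "h \<in> F" for h
        using facet[OF that] s by (simp add: A.scale A.neg field_simps)
      then have "A (- (1 / s) *\<^sub>R x) \<in> K" using K by blast
      then have "1 \<le> inner z (- (1 / s) *\<^sub>R x)" using z unfolding antipolar_def by blast
      with s pos show False by (simp add: field_simps)
    qed
  qed
  with GP obtain y where y: "- z = adjoint A y" "\<forall>u\<in>K. inner y u \<le> - 1"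
    by (auto simp: P_def)
  show ?thesis
  proof (rule that)
    show "- y \<in> antipolar K" using y(2) by (force simp: antipolar_def)
    show "z = adjoint A (- y)" using y(1) by (simp add: linear_neg[OF adj] flip: y(1))
  qed
qed

section \<open>Sublevel sets and polars of gauges\<close>

lemma gauge_function_convex_sublevel:
  assumes "gauge_function \<rho>"
  shows "convex {v. \<rho> v \<le> ereal \<sigma>}"
proof (rule convexI, clarify)
  fix x y and u v :: real
  assume le: "\<rho> x \<le> ereal \<sigma>" "\<rho> y \<le> ereal \<sigma>" and uv: "0 \<le> u" "0 \<le> v" "u + v = 1"
  show "\<rho> (u *\<^sub>R x + v *\<^sub>R y) \<le> ereal \<sigma>"
  proof (cases "u = 0 \<or> v = 0")
    case True
    with le uv show ?thesis by auto
  next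
    case False
    with uv have "0 < v" "v < 1" "u = 1 - v" by auto
    then have "\<rho> (u *\<^sub>R x + v *\<^sub>R y) \<le> ereal u * \<rho> x + ereal v * \<rho> y"
      using assms by (auto simp: gauge_function_def)
    also have "\<dots> \<le> ereal u * ereal \<sigma> + ereal v * ereal \<sigma>"
      using le uv by (intro add_mono ereal_mult_left_mono) auto
    also have "\<dots> = ereal \<sigma>" using uv by (simp flip: distrib_right)
    finally show ?thesis .
  qed
qed

text \<open>Forward, each admissible \<mu> gives \<open>inner v y \<le> \<mu> * \<sigma>\<close> on
  the sublevel set. Backward, rescaling points into the sublevel set shows that every \<mu> above
  \<open>c / \<sigma>\<close> is admissible.\<close>

lemma scaled_polar_gauge_le_iff:
  assumes "gauge_function \<rho>" "0 < \<sigma>"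
  shows "ereal \<sigma> * polar_gauge \<rho> y \<le> ereal c \<longleftrightarrow>
    (\<forall>v. \<rho> v \<le> ereal \<sigma> \<longrightarrow> inner v y \<le> c)"
proof (intro iffI allI impI)
  fix v assume c: "ereal \<sigma> * polar_gauge \<rho> y \<le> ereal c" and v: "\<rho> v \<le> ereal \<sigma>"
  have "ereal (inner v y / \<sigma>) \<le> polar_gauge \<rho> y"
    unfolding polar_gauge_def
  proof (rule Inf_greatest, clarify)
    fix \<mu> :: real assume \<mu>: "0 < \<mu>" "\<forall>x. ereal (inner x y) \<le> ereal \<mu> * \<rho> x"
    then have "ereal (inner v y) \<le> ereal \<mu> * \<rho> v" by blast
    also have "\<dots> \<le> ereal \<mu> * ereal \<sigma>" using v \<mu> by (intro ereal_mult_left_mono) auto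
    finally show "ereal (inner v y / \<sigma>) \<le> ereal \<mu>" using \<open>0 < \<sigma>\<close> by (simp add: field_simps)
  qed
  then have "ereal \<sigma> * ereal (inner v y / \<sigma>) \<le> ereal \<sigma> * polar_gauge \<rho> y"
    using \<open>0 < \<sigma>\<close> by (intro ereal_mult_left_mono) auto
  also note c
  finally have "ereal (inner v y) \<le> ereal c" using \<open>0 < \<sigma>\<close> by simp
  then show "inner v y \<le> c" by simp
next
  assume c: "\<forall>v. \<rho> v \<le> ereal \<sigma> \<longrightarrow> inner v y \<le> c"
  note \<rho> = assms(1)[unfolded gauge_function_def]
  have "c \<ge> 0" using c[rule_format, of 0] \<rho> \<open>0 < \<sigma>\<close> by simp
  \<comment> \<open>Allowing any positive upper bound \<open>r\<close> of the gauge covers points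
    where the gauge is 0 and division by it is impossible.\<close>
  have bound: "inner x y * \<sigma> \<le> c * r" if x: "\<rho> x \<le> ereal r" and r: "r > 0" for x r
  proof -
    have "\<rho> ((\<sigma> / r) *\<^sub>R x) = ereal (\<sigma> / r) * \<rho> x" using \<rho> r \<open>0 < \<sigma>\<close> by simp
    also have "\<dots> \<le> ereal (\<sigma> / r) * ereal r"
      using x r \<open>0 < \<sigma>\<close> by (intro ereal_mult_left_mono) auto
    finally have "\<rho> ((\<sigma> / r) *\<^sub>R x) \<le> ereal \<sigma>" using r by simp
    with c have "inner ((\<sigma> / r) *\<^sub>R x) y \<le> c" by blast
    then show ?thesis using r by (simp add: field_simps)
  qed
  \<comment> \<open>The strict inequality keeps \<mu> positive even when \<open>c = 0\<close>; the
    limit is taken at the end.\<close>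
  have "polar_gauge \<rho> y \<le> ereal \<mu>" if \<mu>: "\<mu> > c / \<sigma>" for \<mu>
    unfolding polar_gauge_def
  proof (rule Inf_lower, clarify, intro exI conjI allI)
    show \<mu>0: "0 < \<mu>" using \<mu> \<open>c \<ge> 0\<close> \<open>0 < \<sigma>\<close> by (meson divide_nonneg_pos le_less_trans)
    fix x
    show "ereal (inner x y) \<le> ereal \<mu> * \<rho> x"
    proof (cases "\<rho> x")
      case PInf
      with \<mu>0 show ?thesis by simp
    next
      case MInf
      with \<rho> show ?thesis by (metis MInfty_neq_ereal(1) ereal_infty_less_eq(2) zero_ereal_def)
    next
      case (real r)
      then have r: "r \<ge> 0" using \<rho> by (metis ereal_less_eq(5))
      define m where "m = c / \<sigma>"
      have m: "m \<ge> 0" using \<open>c \<ge> 0\<close> \<open>0 < \<sigma>\<close> by (simp add: m_def)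
      have "inner x y \<le> m * r"
      proof (rule field_le_epsilon)
        fix e :: real assume e: "e > 0"
        \<comment> \<open>The increment \<open>e / (m + 1)\<close> keeps the level positive, costs
          at most \<open>e\<close> after multiplication by \<open>m\<close>, and is safe for
          \<open>m = 0\<close>.\<close>
        have "inner x y * \<sigma> \<le> c * (r + e / (m + 1))"
          using real r e m by (intro bound) (auto intro!: add_nonneg_pos)
        then have "inner x y \<le> m * (r + e / (m + 1))"
          using \<open>0 < \<sigma>\<close> by (simp add: m_def pos_le_divide_eq)
        also have "\<dots> \<le> m * r + e"
          using e m by (simp add: distrib_left pos_divide_le_eq distrib_right mult.commute)
        finally show "inner x y \<le> m * r + e" .
      qed
      also have "\<dots> \<le> \<mu> * r" using \<mu> r by (intro mult_right_mono) (auto simp: m_def)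
      finally show ?thesis by (simp add: real)
    qed
  qed simp
  from this[of "c / \<sigma> + e" for e] have "polar_gauge \<rho> y \<le> ereal (c / \<sigma>) + ereal e" if "0 < e" for e
    using that by simp
  then have "polar_gauge \<rho> y \<le> ereal (c / \<sigma>)"
    using ereal_le_epsilon2 by blast
  then have "ereal \<sigma> * polar_gauge \<rho> y \<le> ereal \<sigma> * ereal (c / \<sigma>)"
    using \<open>0 < \<sigma>\<close> by (intro ereal_mult_left_mono) auto
  then show "ereal \<sigma> * polar_gauge \<rho> y \<le> ereal c" using \<open>0 < \<sigma>\<close> by simp
qed

lemma polar_constraint_iff_antipolar:
  assumes "gauge_function \<rho>" "0 < \<sigma>"
  shows "1 \<le> ereal (inner b y) - ereal \<sigma> * polar_gauge \<rho> y \<longleftrightarrow>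
    y \<in> antipolar {u. \<rho> (b - u) \<le> ereal \<sigma>}"
proof -
  \<comment> \<open>If the polar is infinite, the difference is minus infinity and both sides
    fail.\<close>
  have "1 \<le> ereal (inner b y) - ereal \<sigma> * polar_gauge \<rho> y \<longleftrightarrow>
      ereal \<sigma> * polar_gauge \<rho> y \<le> ereal (inner b y - 1)"
    by (cases "ereal \<sigma> * polar_gauge \<rho> y") (auto simp: one_ereal_def)
  also have "\<dots> \<longleftrightarrow> (\<forall>v. \<rho> v \<le> ereal \<sigma> \<longrightarrow> inner v y \<le> inner b y - 1)"
    by (rule scaled_polar_gauge_le_iff[OF assms])
  also have "\<dots> \<longleftrightarrow> (\<forall>u. \<rho> (b - u) \<le> ereal \<sigma> \<longrightarrow> inner (b - u) y \<le> inner b y - 1)"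
    by (metis diff_diff_eq2 add_diff_cancel_left')
  finally show ?thesis
    by (simp add: antipolar_def inner_commute[of _ y] inner_diff_right)
qed

theorem corollary4p1:
  fixes A :: "'a::euclidean_space \<Rightarrow> 'b::euclidean_space"
    and b :: 'b
    and \<rho> :: "'b \<Rightarrow> ereal"
    and \<sigma> :: real
    and C :: "'a set"
    and C0 :: "'b set"
  assumes "linear A"
    and "closed_gauge \<rho>"
    and "0 < \<sigma>" and "ereal \<sigma> < \<rho> b"
    and "C = {x. \<rho> (b - A x) \<le> ereal \<sigma>}"
    and "C0 = {u. \<rho> (b - u) \<le> ereal \<sigma>}"
    and "C \<noteq> {}"
    and "polyhedron C0 \<or> rel_interior C0 \<inter> range A \<noteq> {}"
  shows "antipolar C =
    {adjoint A y | y. ereal (inner b y) - ereal \<sigma> * polar_gauge \<rho> y \<ge> 1}"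
proof -
  have gauge: "gauge_function \<rho>" using assms(2) by (simp add: closed_gauge_def)
  have C: "C = A -` C0" using assms(5,6) by auto
  \<comment> \<open>Reflection and translation carry convexity over from the sublevel set.\<close>
  have "C0 = (\<lambda>v. b - v) ` {v. \<rho> v \<le> ereal \<sigma>}"
    by (force simp: assms(6) image_iff algebra_simps)
  then have "convex C0"
    using convex_translation[OF convex_negations[OF gauge_function_convex_sublevel[OF gauge]], of b \<sigma>]
    by (simp add: image_image)
  have "antipolar C = adjoint A ` antipolar C0"
  proof
    show "adjoint A ` antipolar C0 \<subseteq> antipolar C"
      by (auto simp: C antipolar_def adjoint_clauses[OF assms(1)])
    show "antipolar C \<subseteq> adjoint A ` antipolar C0"
    proof
      fix z assume "z \<in> antipolar C"
      then show "z \<in> adjoint A ` antipolar C0"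
        using assms(8) assms(7) \<open>convex C0\<close> unfolding C
        by (metis antipolar_vimage_rel_interior[OF assms(1)]
            antipolar_vimage_polyhedron[OF assms(1)] imageI)
    qed
  qed
  then show ?thesis
    unfolding polar_constraint_iff_antipolar[OF gauge assms(3)] assms(6)[symmetric] by blast
qed

end
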